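(* Let $\mathrm{OPT}(d)$ be the minimum size of a hub labeling of the $d$-dimensional hypercube $Q_d$. Then $\mathrm{OPT}(d)=(2.5+o(1))^d$ as $d\to\infty$. *)

theory Defs
  imports Complex_Main
begin

text \<open>The d-dimensional hypercube Q_d: vertices are the subsets of {0..<d}
  (equivalently 0/1 vectors of length d); the graph distance is the Hamming
  distance, i.e. the cardinality of the symmetric difference.\<close>

definition cube_vertices :: "nat \<Rightarrow> nat set set" where
  "cube_vertices d = Pow {..<d}"

definition cube_dist :: "nat set \<Rightarrow> nat set \<Rightarrow> nat" where
  "cube_dist u v = card ((u - v) \<union> (v - u))"

definition on_shortest_path :: "nat set \<Rightarrow> nat set \<Rightarrow> nat set \<Rightarrow> bool" where
  "on_shortest_path u w v \<longleftrightarrow> cube_dist u w + cube_dist w v = cube_dist u v"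

definition hub_labeling :: "nat \<Rightarrow> (nat set \<Rightarrow> nat set set) \<Rightarrow> bool" where
  "hub_labeling d L \<longleftrightarrow>
     (\<forall>v\<in>cube_vertices d. L v \<subseteq> cube_vertices d) \<and>
     (\<forall>u\<in>cube_vertices d. \<forall>v\<in>cube_vertices d.
        \<exists>w\<in>L u \<inter> L v. on_shortest_path u w v)"

definition hub_size :: "nat \<Rightarrow> (nat set \<Rightarrow> nat set set) \<Rightarrow> nat" where
  "hub_size d L = (\<Sum>v\<in>cube_vertices d. card (L v))"

definition OPT :: "nat \<Rightarrow> nat" where
  "OPT d = (LEAST s. \<exists>L. hub_labeling d L \<and> hub_size d L = s)"

end

theory Submission
  imports Defs "HOL-Real_Asymp.Real_Asymp"
begin

text \<open>
  Lower bound: if $u$ and $v$ are at distance $2m$, their common hub is at distance at least $m$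
  from one of them. A hub $w$ of $u$ with $d(u,w) \<ge> m$ serves at most $\binom{d-m}{m}$ such $v$,
  so double counting gives $2\,\mathrm{OPT}(d) \<ge> 2^d \binom{d}{m} / \binom{2m}{m}
  \<ge> 2^d \binom{d}{m} 4^{-m}$, and $\sum_m \binom{d}{m} 4^{-m} = (5/4)^d$.

  Upper bound: a pair at distance $k$ has $\binom{k}{\lfloor k/2 \rfloor}$ midpoints, so random
  sampling yields a set of $O(d\,2^d / \binom{k}{\lfloor k/2 \rfloor})$ vertices containing a
  midpoint of every such pair. Each of these serves as a hub for its spheres of radii
  $\lfloor k/2 \rfloor$ and $\lceil k/2 \rceil$. Both bounds are $(5/2)^d$ up to a polynomial
  factor in $d$.
\<close>

section \<open>Counting in the cube\<close>

lemma finite_cube [simp]: "finite (cube_vertices d)"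
  by (simp add: cube_vertices_def)

lemma card_cube [simp]: "card (cube_vertices d) = 2 ^ d"
  by (simp add: cube_vertices_def card_Pow)

lemma finite_cubeD: "u \<in> cube_vertices d \<Longrightarrow> finite u"
  by (auto simp: cube_vertices_def intro: finite_subset)

lemma sym_diff_in_cube:
  "u \<in> cube_vertices d \<Longrightarrow> v \<in> cube_vertices d \<Longrightarrow> sym_diff u v \<in> cube_vertices d"
  by (auto simp: cube_vertices_def)

lemma cube_dist_sym: "cube_dist u v = cube_dist v u"
  by (simp add: cube_dist_def Un_commute)

lemma inj_on_sym_diff: "inj_on (sym_diff u) A"
  by (rule inj_onI) blast

text \<open>\<open>sym_diff u\<close> is an involution of the cube that carries \<open>u\<close> to
  the empty set, so spheres about \<open>u\<close> become layers of sets of fixed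
  cardinality.\<close>

lemma card_sphere:
  assumes u: "u \<in> cube_vertices d"
  shows "card {v \<in> cube_vertices d. cube_dist u v = j} = d choose j"
proof -
  have "bij_betw (sym_diff u) {B. B \<subseteq> {..<d} \<and> card B = j} {v \<in> cube_vertices d. cube_dist u v = j}"
    unfolding bij_betw_def
  proof (intro conjI inj_on_sym_diff equalityI subsetI)
    fix v assume "v \<in> sym_diff u ` {B. B \<subseteq> {..<d} \<and> card B = j}"
    then obtain B where B: "B \<subseteq> {..<d}" "card B = j" "v = sym_diff u B" by blast
    have "sym_diff u v = B" using B(3) by blast
    then show "v \<in> {v \<in> cube_vertices d. cube_dist u v = j}"
      using B u by (auto simp: cube_dist_def cube_vertices_def)
  next
    fix v assume v: "v \<in> {v \<in> cube_vertices d. cube_dist u v = j}"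
    have "v = sym_diff u (sym_diff u v)" by blast
    moreover have "sym_diff u v \<in> {B. B \<subseteq> {..<d} \<and> card B = j}"
      using v sym_diff_in_cube[OF u, of v] by (auto simp: cube_dist_def cube_vertices_def)
    ultimately show "v \<in> sym_diff u ` {B. B \<subseteq> {..<d} \<and> card B = j}" by (rule image_eqI)
  qed
  then have "card {v \<in> cube_vertices d. cube_dist u v = j} = card {B. B \<subseteq> {..<d} \<and> card B = j}"
    by (rule bij_betw_same_card[symmetric])
  then show ?thesis by (simp add: n_subsets)
qed

text \<open>Flipping in \<open>u\<close> any \<open>m\<close> of the \<open>k\<close> coordinates
  where \<open>u\<close> and \<open>v\<close> differ gives such a point, and different choices give
  different points. With \<open>m = k div 2\<close> these are the midpoints used in the upper
  bound.\<close>

lemma card_points_between: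
  assumes u: "u \<in> cube_vertices d" and v: "v \<in> cube_vertices d" and k: "cube_dist u v = k"
  shows "k choose m \<le> card {w \<in> cube_vertices d. cube_dist u w = m \<and> cube_dist w v = k - m}"
proof -
  let ?D = "sym_diff u v"
  have fin: "finite ?D" using u v by (auto dest: finite_cubeD)
  have "sym_diff u ` {B. B \<subseteq> ?D \<and> card B = m}
      \<subseteq> {w \<in> cube_vertices d. cube_dist u w = m \<and> cube_dist w v = k - m}"
  proof
    fix w assume "w \<in> sym_diff u ` {B. B \<subseteq> ?D \<and> card B = m}"
    then obtain B where B: "B \<subseteq> ?D" "card B = m" "w = sym_diff u B" by blast
    have "sym_diff u w = B" "sym_diff w v = ?D - B" using B(1,3) by blast+
    moreover have "card (?D - B) = k - m"
      using B fin k by (simp add: card_Diff_subset finite_subset cube_dist_def)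
    moreover have "w \<in> cube_vertices d" using B u v by (auto simp: cube_vertices_def)
    ultimately show "w \<in> {w \<in> cube_vertices d. cube_dist u w = m \<and> cube_dist w v = k - m}"
      using B(2) by (simp add: cube_dist_def)
  qed
  then have "card (sym_diff u ` {B. B \<subseteq> ?D \<and> card B = m})
      \<le> card {w \<in> cube_vertices d. cube_dist u w = m \<and> cube_dist w v = k - m}"
    by (intro card_mono) auto
  then show ?thesis
    using fin k by (simp add: card_image[OF inj_on_sym_diff] n_subsets cube_dist_def)
qed

text \<open>Along a shortest path no coordinate is flipped twice, so the step from \<open>w\<close>
  to \<open>v\<close> flips a \<open>(k - j)\<close>-subset of the \<open>d - j\<close> coordinates
  untouched between \<open>u\<close> and \<open>w\<close>.\<close>

lemma card_extensions:
  assumes u: "u \<in> cube_vertices d" and w: "w \<in> cube_vertices d" and j: "cube_dist u w = j"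
  shows "card {v \<in> cube_vertices d. cube_dist u v = k \<and> on_shortest_path u w v} \<le> (d - j) choose (k - j)"
proof -
  let ?A = "sym_diff u w"
  have A: "finite ?A" "?A \<subseteq> {..<d}" using u w by (auto simp: cube_vertices_def intro: finite_subset)
  have "sym_diff w ` {v \<in> cube_vertices d. cube_dist u v = k \<and> on_shortest_path u w v}
      \<subseteq> {B. B \<subseteq> {..<d} - ?A \<and> card B = k - j}"
  proof
    fix B assume "B \<in> sym_diff w ` {v \<in> cube_vertices d. cube_dist u v = k \<and> on_shortest_path u w v}"
    then obtain v where v: "v \<in> cube_vertices d" "cube_dist u v = k" "on_shortest_path u w v"
      and B: "B = sym_diff w v" by blast
    have Bd: "B \<subseteq> {..<d}" "finite B" using v(1) w B by (auto simp: cube_vertices_def intro: finite_subset)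
    have e: "sym_diff u v = sym_diff ?A B" using B by blast
    have "card ?A + card B = card (sym_diff ?A B)"
      using v(3) e B by (simp add: on_shortest_path_def cube_dist_def)
    also have "\<dots> = card (?A - B) + card (B - ?A)"
      using A(1) Bd(2) by (intro card_Un_disjoint) auto
    also have "\<dots> = (card ?A - card (?A \<inter> B)) + (card B - card (?A \<inter> B))"
      using A(1) Bd(2) by (metis Int_commute card_Diff_subset_Int finite_Int)
    \<comment> \<open>An equation a + b = (a - i) + (b - i) yields i = 0 once truncated subtraction
      is excluded; the two cardinality bounds exclude it.\<close>
    finally have "card (?A \<inter> B) = 0"
      using card_mono[OF A(1), of "?A \<inter> B"] card_mono[OF Bd(2), of "?A \<inter> B"] by auto
    then have "?A \<inter> B = {}" using A(1) by simp
    moreover have "card B = k - j"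
      using v(2,3) j B by (simp add: on_shortest_path_def cube_dist_def)
    ultimately show "B \<in> {B. B \<subseteq> {..<d} - ?A \<and> card B = k - j}" using Bd by blast
  qed
  then have "card (sym_diff w ` {v \<in> cube_vertices d. cube_dist u v = k \<and> on_shortest_path u w v})
     \<le> card {B. B \<subseteq> {..<d} - ?A \<and> card B = k - j}"
    by (intro card_mono) auto
  then show ?thesis
    using A j by (simp add: card_image[OF inj_on_sym_diff] n_subsets card_Diff_subset cube_dist_def)
qed

section \<open>The lower bound\<close>

text \<open>Giving every vertex the whole cube as its label is valid, since \<open>u\<close> itself
  serves as a hub for \<open>u\<close> and \<open>v\<close>. So the \<open>LEAST\<close> in
  \<open>OPT\<close> ranges over a nonempty set.\<close>

lemma OPT_attained: "\<exists>L. hub_labeling d L \<and> hub_size d L = OPT d"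
proof -
  have "hub_labeling d (\<lambda>_. cube_vertices d)"
    unfolding hub_labeling_def
  proof (intro conjI ballI)
    fix u v assume "u \<in> cube_vertices d" "v \<in> cube_vertices d"
    then show "\<exists>w\<in>cube_vertices d \<inter> cube_vertices d. on_shortest_path u w v"
      by (intro bexI[of _ u]) (auto simp: on_shortest_path_def cube_dist_def)
  qed simp
  then have "\<exists>s L. hub_labeling d L \<and> hub_size d L = s" by blast
  then show ?thesis unfolding OPT_def by (rule LeastI_ex)
qed

lemma OPT_le: "hub_labeling d L \<Longrightarrow> OPT d \<le> hub_size d L"
  unfolding OPT_def by (rule Least_le) blast

text \<open>Ordered pairs at distance \<open>2 * m\<close> are counted exactly, then bounded by
  charging each pair to a far hub of one endpoint. Multiplying by \<open>2 * m choose m\<close>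
  makes the factor \<open>?c\<close> appear on both sides, where it cancels.\<close>

lemma hub_size_lower_bound:
  assumes L: "hub_labeling d L" and m: "2 * m \<le> d"
  shows "2 ^ d * (d choose m) \<le> 2 * hub_size d L * (2 * m choose m)"
proof -
  let ?V = "cube_vertices d" and ?c = "(d - m) choose m"
  let ?E = "\<lambda>u w. {v \<in> ?V. cube_dist u v = 2 * m \<and> on_shortest_path u w v}"
  define P where "P = (SIGMA u:?V. {v \<in> ?V. cube_dist u v = 2 * m})"
  \<comment> \<open>Here the far hub belongs to the first endpoint. Pairs whose far hub belongs to
    the second endpoint lie in the converse of \<open>A\<close>, whence the factor 2.\<close>
  define A where "A = (SIGMA u:?V. \<Union>w\<in>{w \<in> L u. m \<le> cube_dist u w}. ?E u w)"
  have LV: "L u \<subseteq> ?V" if "u \<in> ?V" for u using L that by (auto simp: hub_labeling_def)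
  have finL: "finite (L u)" if "u \<in> ?V" for u using LV[OF that] finite_cube by (rule finite_subset)
  have finA: "finite A" unfolding A_def using finL by (intro finite_SigmaI) auto
  have P: "P \<subseteq> A \<union> A\<inverse>"
  proof
    fix p assume "p \<in> P"
    then obtain u v where p: "p = (u, v)" "u \<in> ?V" "v \<in> ?V" "cube_dist u v = 2 * m"
      by (auto simp: P_def)
    then obtain w where w: "w \<in> L u" "w \<in> L v" "on_shortest_path u w v"
      using L unfolding hub_labeling_def by blast
    have w': "on_shortest_path v w u" using w(3)
      by (simp add: on_shortest_path_def cube_dist_sym[of v] cube_dist_sym[of w u])
    have "m \<le> cube_dist u w \<or> m \<le> cube_dist v w"
      using w(3) p(4) unfolding on_shortest_path_def cube_dist_sym[of v w] by linarith
    then show "p \<in> A \<union> A\<inverse>"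
      using p w w' cube_dist_sym[of u v] unfolding A_def by auto
  qed
  have E: "card (?E u w) \<le> ?c" if "u \<in> ?V" "w \<in> L u" "m \<le> cube_dist u w" for u w
  proof (cases "cube_dist u w \<le> 2 * m")
    case True
    let ?j = "cube_dist u w"
    have "card (?E u w) \<le> (d - ?j) choose (2 * m - ?j)"
      using that LV by (intro card_extensions) auto
    \<comment> \<open>Passing to the complement makes the lower index independent of
      \<open>?j\<close>, so monotonicity in the upper index applies; the worst case is
      \<open>?j = m\<close>.\<close>
    also have "\<dots> = (d - ?j) choose (d - 2 * m)"
      using True m binomial_symmetric[of "2 * m - ?j" "d - ?j"] by (simp add: diff_diff_eq)
    also have "\<dots> \<le> (d - m) choose (d - 2 * m)"
      using that(3) by (intro binomial_right_mono) auto
    also have "\<dots> = ?c"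
      using m binomial_symmetric[of m "d - m"] by (simp add: diff_diff_eq mult_2)
    finally show ?thesis .
  next
    case False
    \<comment> \<open>A point farther than \<open>2 * m\<close> from \<open>u\<close> lies on no
      shortest path of length \<open>2 * m\<close> starting at \<open>u\<close>.\<close>
    then have empty: "?E u w = {}" by (auto simp: on_shortest_path_def)
    show ?thesis unfolding empty by simp
  qed
  have "card A = (\<Sum>u\<in>?V. card (\<Union>w\<in>{w \<in> L u. m \<le> cube_dist u w}. ?E u w))"
    unfolding A_def using finL by (intro card_SigmaI) auto
  also have "\<dots> \<le> (\<Sum>u\<in>?V. card (L u) * ?c)"
  proof (rule sum_mono)
    fix u assume u: "u \<in> ?V"
    have "card (\<Union>w\<in>{w \<in> L u. m \<le> cube_dist u w}. ?E u w)
        \<le> (\<Sum>w\<in>{w \<in> L u. m \<le> cube_dist u w}. card (?E u w))"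
      using finL[OF u] by (intro card_UN_le) auto
    also have "\<dots> \<le> (\<Sum>w\<in>{w \<in> L u. m \<le> cube_dist u w}. ?c)"
      using E u by (intro sum_mono) auto
    also have "\<dots> \<le> card (L u) * ?c"
      using finL[OF u] by (auto intro: card_mono)
    finally show "card (\<Union>w\<in>{w \<in> L u. m \<le> cube_dist u w}. ?E u w) \<le> card (L u) * ?c" .
  qed
  finally have cA: "card A \<le> hub_size d L * ?c" by (simp add: hub_size_def sum_distrib_right)
  have "2 ^ d * (d choose (2 * m)) = card P"
    unfolding P_def by (subst card_SigmaI) (simp_all add: card_sphere)
  also have "\<dots> \<le> card (A \<union> A\<inverse>)" using P finA by (intro card_mono) auto
  also have "\<dots> \<le> card A + card (A\<inverse>)" by (rule card_Un_le)
  also have "\<dots> \<le> 2 * hub_size d L * ?c" using cA by simp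
  finally have "2 ^ d * ((d choose (2 * m)) * (2 * m choose m)) \<le> 2 * hub_size d L * ?c * (2 * m choose m)"
    using mult_le_mono1 by (simp only: flip: mult.assoc)
  \<comment> \<open>Both sides count pairs of disjoint \<open>m\<close>-subsets of a
    \<open>d\<close>-set.\<close>
  also have "(d choose (2 * m)) * (2 * m choose m) = (d choose m) * ?c"
    using choose_mult[of m "2 * m" d] m by simp
  finally have "?c * (2 ^ d * (d choose m)) \<le> ?c * (2 * hub_size d L * (2 * m choose m))"
    by (simp only: mult_ac)
  moreover have "?c > 0" using m by (intro zero_less_binomial) auto
  ultimately show ?thesis by simp
qed

text \<open>The binomial theorem for 1/4 + 1. The lower bound uses that some term is at least the
  average, the upper bound that no term exceeds the sum.\<close>

lemma sum_binomial_over_4: "(\<Sum>m\<le>d. real (d choose m) / 4 ^ m) = (5/4) ^ d"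
  using binomial_ring[of "1/4::real" 1 d] by (simp add: power_one_over field_simps)

text \<open>The largest of \<open>d + 1\<close> terms is at least their average. The condition on
  \<open>m\<close> is there because the double count uses pairs at distance \<open>2 * m\<close> in
  the cube.\<close>

lemma exists_large_term:
  obtains m where "2 * m \<le> d" "(5/4) ^ d \<le> real (d + 1) * (real (d choose m) / 4 ^ m)"
proof -
  let ?t = "\<lambda>m. real (d choose m) / 4 ^ m"
  obtain m where m: "m \<le> d" "\<And>n. n \<le> d \<Longrightarrow> ?t n \<le> ?t m"
    using Max_in[of "?t ` {..d}"] Max_ge[of "?t ` {..d}"] by fastforce
  have "(\<Sum>n\<le>d. ?t n) \<le> (\<Sum>n\<le>d. ?t m)" using m by (intro sum_mono) auto
  then have big: "(5/4) ^ d \<le> real (d + 1) * ?t m" by (simp add: sum_binomial_over_4)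
  show thesis
  proof (cases "2 * m \<le> d")
    case True
    then show thesis using big that by blast
  next
    case False
    \<comment> \<open>Reflecting $m$ keeps the binomial coefficient and lowers the power of 4.\<close>
    have "?t m \<le> ?t (d - m)"
      using False m(1) binomial_symmetric[OF m(1)]
      by (auto intro!: divide_left_mono power_increasing)
    then have "(5/4) ^ d \<le> real (d + 1) * ?t (d - m)"
      using big by (meson mult_left_mono of_nat_0_le_iff order_trans)
    then show thesis using False by (intro that[of "d - m"]) auto
  qed
qed

text \<open>Bounding \<open>2 * m choose m\<close> by \<open>4 ^ m\<close> turns the double count
  into \<open>2 ^ d\<close> times a term of the sum for \<open>(5/4) ^ d\<close>; taking a large
  term costs only the factor \<open>d + 1\<close>.\<close>

lemma OPT_lower: "(5/2) ^ d \<le> 2 * real (d + 1) * real (OPT d)"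
proof -
  obtain L where L: "hub_labeling d L" "hub_size d L = OPT d" using OPT_attained by blast
  obtain m where m: "2 * m \<le> d" "(5/4) ^ d \<le> real (d + 1) * (real (d choose m) / 4 ^ m)"
    by (rule exists_large_term)
  have "2 * m choose m \<le> 4 ^ m"
    using binomial_le_pow2[of "2 * m" m] by (simp add: power_mult)
  then have "2 ^ d * (d choose m) \<le> 2 * OPT d * 4 ^ m"
    using hub_size_lower_bound[OF L(1) m(1)] unfolding L(2) by (meson le_trans mult_le_mono2)
  then have "2 ^ d * real (d choose m) \<le> 2 * real (OPT d) * 4 ^ m"
    by (metis (mono_tags) of_nat_le_iff of_nat_mult of_nat_numeral of_nat_power)
  then have h: "2 ^ d * (real (d choose m) / 4 ^ m) \<le> 2 * real (OPT d)"
    by (simp add: field_simps)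
  have "(5/2 :: real) ^ d = 2 ^ d * (5/4) ^ d" by (simp flip: power_mult_distrib)
  also have "\<dots> \<le> 2 ^ d * (real (d + 1) * (real (d choose m) / 4 ^ m))"
    using m(2) by (intro mult_left_mono) auto
  also have "\<dots> = real (d + 1) * (2 ^ d * (real (d choose m) / 4 ^ m))" by simp
  also have "\<dots> \<le> real (d + 1) * (2 * real (OPT d))"
    using h by (intro mult_left_mono) auto
  finally show ?thesis by (simp only: mult_ac)
qed

section \<open>The upper bound\<close>

lemma hitting_set_exists:
  assumes V: "finite V" and F: "finite F"
    and sub: "\<And>A. A \<in> F \<Longrightarrow> A \<subseteq> V" and s: "\<And>A. A \<in> F \<Longrightarrow> s \<le> card A"
    and few: "card F * (card V - s) ^ t < card V ^ t"
  obtains W where "W \<subseteq> V" "card W \<le> t" "\<And>A. A \<in> F \<Longrightarrow> W \<inter> A \<noteq> {}"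
proof -
  \<comment> \<open>The union bound for \<open>t\<close> independent samples, as a count of lists of length \<open>t\<close>.\<close>
  let ?S = "\<lambda>U. {xs. set xs \<subseteq> U \<and> length xs = t}"
  have "card (\<Union>A\<in>F. ?S (V - A)) \<le> (\<Sum>A\<in>F. card (?S (V - A)))"
    using F by (rule card_UN_le)
  also have "\<dots> \<le> (\<Sum>A\<in>F. (card V - s) ^ t)"
  proof (rule sum_mono)
    fix A assume A: "A \<in> F"
    have "card (V - A) \<le> card V - s"
      using sub[OF A] s[OF A] V by (simp add: card_Diff_subset finite_subset)
    then show "card (?S (V - A)) \<le> (card V - s) ^ t"
      using V by (simp add: card_lists_length_eq power_mono)
  qed
  also have "\<dots> < card (?S V)" using few V by (simp add: card_lists_length_eq)
  finally have "card (\<Union>A\<in>F. ?S (V - A)) < card (?S V)" .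
  moreover have "finite (\<Union>A\<in>F. ?S (V - A))"
    using F V by (intro finite_UN_I finite_lists_length_eq) auto
  ultimately have "\<not> ?S V \<subseteq> (\<Union>A\<in>F. ?S (V - A))"
    by (meson card_mono not_less)
  then obtain xs where xs: "set xs \<subseteq> V" "length xs = t" "xs \<notin> (\<Union>A\<in>F. ?S (V - A))" by blast
  show thesis
  proof (rule that[OF xs(1)])
    show "card (set xs) \<le> t" using card_length[of xs] xs(2) by simp
    show "set xs \<inter> A \<noteq> {}" if "A \<in> F" for A using xs that by blast
  qed
qed

text \<open>By 1 - x \<le> exp(-x), a set of density \<open>s / N\<close> is missed by
  \<open>t\<close> samples with probability at most exp(-ts/N). The bound on \<open>t\<close> makes
  this less than exp(-2d), which is at most 4^(-d) because e \<ge> 2. The factor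
  \<open>4 ^ d\<close> is the number of ordered pairs of vertices.\<close>

lemma sampling_estimate:
  fixes N s d t :: nat
  assumes s: "0 < s" "s \<le> N" and t: "2 * real d * real N / real s < real t"
  shows "4 ^ d * (N - s) ^ t < N ^ t"
proof -
  have N: "real N > 0" using s by simp
  have "(1 - real s / real N) ^ t \<le> exp (- (real s / real N)) ^ t"
    using s exp_ge_add_one_self[of "- (real s / real N)"] by (intro power_mono) auto
  also have "\<dots> = exp (- (real t * (real s / real N)))" by (simp flip: exp_of_nat_mult)
  also have "\<dots> < exp (- (2 * real d))"
    using t s N by (simp add: field_simps)
  also have "\<dots> = 1 / (exp 1 ^ 2) ^ d"
    by (simp add: exp_minus divide_inverse flip: exp_of_nat_mult power_mult)
  also have "\<dots> \<le> 1 / (2 ^ 2) ^ d"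
    using exp_ge_add_one_self[of 1] by (intro divide_left_mono power_mono) auto
  finally have "4 ^ d * (1 - real s / real N) ^ t < 1" by (simp add: field_simps)
  then have "4 ^ d * (1 - real s / real N) ^ t * real N ^ t < 1 * real N ^ t"
    using N by (intro mult_strict_right_mono) auto
  also have "4 ^ d * (1 - real s / real N) ^ t * real N ^ t = 4 ^ d * ((1 - real s / real N) * real N) ^ t"
    by (simp add: power_mult_distrib)
  also have "(1 - real s / real N) * real N = real (N - s)"
    using N s by (simp add: field_simps of_nat_diff)
  finally have "real (4 ^ d * (N - s) ^ t) < real (N ^ t)" by simp
  then show ?thesis by (simp only: of_nat_less_iff)
qed

text \<open>Sampling is applied to the midpoint sets of all ordered pairs at distance
  \<open>k\<close>. For odd \<open>k\<close> a midpoint is the point nearer to the first vertex by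
  one step.\<close>

lemma midpoint_hubs_exist:
  assumes k: "k \<le> d"
  obtains W where "W \<subseteq> cube_vertices d"
    "real (card W) \<le> (2 * real d + 2) * 2 ^ d / real (k choose (k div 2))"
    "\<And>u v. u \<in> cube_vertices d \<Longrightarrow> v \<in> cube_vertices d \<Longrightarrow> cube_dist u v = k \<Longrightarrow>
       \<exists>w\<in>W. cube_dist u w = k div 2 \<and> cube_dist w v = k - k div 2"
proof -
  let ?V = "cube_vertices d" and ?s = "k choose (k div 2)"
  define mid where "mid = (\<lambda>(u, v). {w \<in> ?V. cube_dist u w = k div 2 \<and> cube_dist w v = k - k div 2})"
  define P where "P = {(u, v) \<in> ?V \<times> ?V. cube_dist u v = k}"
  \<comment> \<open>The least natural number strictly above the threshold in
    \<open>sampling_estimate\<close>.\<close>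
  define t where "t = Suc (nat \<lfloor>2 * real d * 2 ^ d / real ?s\<rfloor>)"
  have P: "P \<subseteq> ?V \<times> ?V" by (auto simp: P_def)
  then have finP: "finite P" by (rule finite_subset) simp
  have "card (mid ` P) \<le> card P" using finP by (rule card_image_le)
  also have "\<dots> \<le> card (?V \<times> ?V)" using P by (intro card_mono) auto
  also have "\<dots> = 4 ^ d" by (simp add: card_cartesian_product flip: power_mult_distrib)
  finally have cF: "card (mid ` P) \<le> 4 ^ d" .
  have s0: "0 < ?s" by (simp add: zero_less_binomial)
  have "?s \<le> 2 ^ k" using binomial_le_pow2 by blast
  also have "\<dots> \<le> 2 ^ d" using k by (simp add: power_increasing)
  finally have s1: "?s \<le> 2 ^ d" .
  have "2 * real d * 2 ^ d / real ?s < real t"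
    unfolding t_def by linarith
  then have "4 ^ d * (2 ^ d - ?s) ^ t < (2 ^ d) ^ t"
    using s0 s1 by (intro sampling_estimate) auto
  then have few: "card (mid ` P) * (card ?V - ?s) ^ t < card ?V ^ t"
    using cF by (metis card_cube le_less_trans mult_le_mono1)
  have "\<exists>W\<subseteq>?V. card W \<le> t \<and> (\<forall>A\<in>mid ` P. W \<inter> A \<noteq> {})"
  proof (rule hitting_set_exists[OF finite_cube _ _ _ few])
    show "finite (mid ` P)" using finP by simp
    show "A \<subseteq> ?V" if "A \<in> mid ` P" for A using that by (auto simp: mid_def)
    show "?s \<le> card A" if "A \<in> mid ` P" for A
      using that by (auto simp: mid_def P_def intro!: card_points_between)
  qed blast
  then obtain W where W: "W \<subseteq> ?V" "card W \<le> t" "\<forall>A\<in>mid ` P. W \<inter> A \<noteq> {}"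
    by (elim exE conjE)
  show thesis
  proof (rule that[OF W(1)])
    have "real (card W) \<le> real t" using W(2) by simp
    also have "\<dots> \<le> 2 * real d * 2 ^ d / real ?s + 1"
      unfolding t_def by (simp add: of_nat_nat)
    \<comment> \<open>The 1 from rounding is absorbed using \<open>?s \<le> 2 ^ d\<close>; this is
      the source of the +2 in \<open>2 * real d + 2\<close>.\<close>
    also have "\<dots> \<le> 2 * real d * 2 ^ d / real ?s + 2 * (2 ^ d / real ?s)"
    proof -
      have "real ?s \<le> 2 ^ d" using s1 by (metis of_nat_le_iff of_nat_numeral of_nat_power)
      then have "1 \<le> 2 ^ d / real ?s" using s0 by (simp add: le_divide_eq)
      then show ?thesis by linarith
    qed
    finally show "real (card W) \<le> (2 * real d + 2) * 2 ^ d / real ?s"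
      by (simp only: distrib_right add_divide_distrib times_divide_eq_right)
    show "\<exists>w\<in>W. cube_dist u w = k div 2 \<and> cube_dist w v = k - k div 2"
      if "u \<in> ?V" "v \<in> ?V" "cube_dist u v = k" for u v
    proof -
      have "mid (u, v) \<in> mid ` P" using that by (simp add: P_def)
      then have "W \<inter> mid (u, v) \<noteq> {}" using W(3) by blast
      then show ?thesis by (auto simp: mid_def)
    qed
  qed
qed

text \<open>Incidences are counted from the side of \<open>W\<close>: each of its points enters the
  labels of the \<open>d choose j\<close> vertices on its sphere of radius \<open>j\<close>.\<close>

lemma sum_card_sphere:
  assumes "W \<subseteq> cube_vertices d"
  shows "(\<Sum>v\<in>cube_vertices d. card {w \<in> W. cube_dist v w = j}) = card W * (d choose j)"
proof -
  have fW: "finite W" using assms finite_cube by (rule finite_subset)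
  have "(\<Sum>v\<in>cube_vertices d. card {w \<in> W. cube_dist v w = j})
      = (\<Sum>w\<in>W. card {v \<in> cube_vertices d. cube_dist v w = j})"
    using sum.swap_restrict[OF finite_cube fW, of "\<lambda>_ _. 1::nat" "\<lambda>v w. cube_dist v w = j"] by simp
  also have "\<dots> = (\<Sum>w\<in>W. d choose j)"
    using assms by (intro sum.cong refl) (auto simp: cube_dist_sym[where v = w for w] card_sphere)
  finally show ?thesis by simp
qed

text \<open>The central coefficient is the largest of \<open>k + 1\<close> numbers with sum
  \<open>2 ^ k\<close>, hence at least \<open>2 ^ k / (k + 1)\<close>. Since
  \<open>4 ^ j \<le> 2 ^ (k + 1)\<close>, the quotient is at most \<open>2 * (d + 1)\<close> times a
  term of the sum for \<open>(5/4) ^ d\<close>. The factor 2 pays for rounding up half of an odd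
  \<open>k\<close>.\<close>

lemma binomial_quotient_le:
  assumes k: "k \<le> d" and j: "j = k div 2 \<or> j = k - k div 2"
  shows "real (d choose j) / real (k choose (k div 2)) \<le> 2 * real (d + 1) * (5/4) ^ d"
proof -
  have jk: "j \<le> d" "2 * j \<le> Suc k" using k j by auto
  have s0: "0 < k choose (k div 2)" by (simp add: zero_less_binomial)
  have "(4::nat) ^ j = 2 ^ (2 * j)" by (simp add: power_mult)
  also have "\<dots> \<le> 2 ^ Suc k" using jk by (intro power_increasing) auto
  also have "(2::nat) ^ k = (\<Sum>i\<le>k. k choose i)" by (simp add: choose_row_sum)
  then have "(2::nat) ^ Suc k = 2 * (\<Sum>i\<le>k. k choose i)" by simp
  also have "\<dots> \<le> 2 * (\<Sum>i\<le>k. k choose (k div 2))"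
    by (intro mult_left_mono sum_mono binomial_maximum) auto
  also have "\<dots> \<le> 2 * (d + 1) * (k choose (k div 2))" using k by simp
  finally have "real (4 ^ j) \<le> real (2 * (d + 1) * (k choose (k div 2)))" by (simp only: of_nat_le_iff)
  then have "1 / real (k choose (k div 2)) \<le> 2 * real (d + 1) / 4 ^ j"
    using s0 by (simp add: field_simps)
  then have "real (d choose j) * (1 / real (k choose (k div 2))) \<le> real (d choose j) * (2 * real (d + 1) / 4 ^ j)"
    by (intro mult_left_mono) auto
  also have "\<dots> = 2 * real (d + 1) * (real (d choose j) / 4 ^ j)" by simp
  also have "real (d choose j) / 4 ^ j \<le> (5/4) ^ d"
    unfolding sum_binomial_over_4[symmetric] using jk by (intro member_le_sum) auto
  finally show ?thesis by (simp add: mult_left_mono)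
qed

text \<open>The three factors \<open>d + 1\<close> come from the sampling, from the central
  coefficient and from the number of distances \<open>k\<close>. The 8 is a product of three twos:
  from the sampling, from the rounding of \<open>k / 2\<close> and from the two radii per
  distance.\<close>

lemma OPT_upper: "real (OPT d) \<le> 8 * real (d + 1) ^ 3 * (5/2) ^ d"
proof -
  let ?V = "cube_vertices d"
  have "\<forall>k\<in>{..d}. \<exists>W. W \<subseteq> ?V \<and>
    real (card W) \<le> (2 * real d + 2) * 2 ^ d / real (k choose (k div 2)) \<and>
    (\<forall>u\<in>?V. \<forall>v\<in>?V. cube_dist u v = k \<longrightarrow>
       (\<exists>w\<in>W. cube_dist u w = k div 2 \<and> cube_dist w v = k - k div 2))"
    by (metis atMost_iff midpoint_hubs_exist)
  then obtain W where W: "\<And>k. k \<le> d \<Longrightarrow> W k \<subseteq> ?V"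
    "\<And>k. k \<le> d \<Longrightarrow> real (card (W k)) \<le> (2 * real d + 2) * 2 ^ d / real (k choose (k div 2))"
    "\<And>k u v. k \<le> d \<Longrightarrow> u \<in> ?V \<Longrightarrow> v \<in> ?V \<Longrightarrow> cube_dist u v = k \<Longrightarrow>
       \<exists>w\<in>W k. cube_dist u w = k div 2 \<and> cube_dist w v = k - k div 2"
    unfolding bchoice_iff atMost_iff by blast
  let ?S = "\<lambda>k v j. {w \<in> W k. cube_dist v w = j}"
  \<comment> \<open>Both radii are included because a vertex may be either the first or the second
    endpoint of a pair at odd distance.\<close>
  define L where "L v = (\<Union>k\<le>d. ?S k v (k div 2) \<union> ?S k v (k - k div 2))" for v
  have hub: "hub_labeling d L"
    unfolding hub_labeling_def
  proof (intro conjI ballI)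
    fix v show "L v \<subseteq> ?V" using W(1) by (auto simp: L_def)
  next
    fix u v assume uv: "u \<in> ?V" "v \<in> ?V"
    let ?k = "cube_dist u v"
    have k: "?k \<le> d"
      using uv card_mono[of "{..<d}" "sym_diff u v"] by (auto simp: cube_dist_def cube_vertices_def)
    obtain w where w: "w \<in> W ?k" "cube_dist u w = ?k div 2" "cube_dist w v = ?k - ?k div 2"
      using W(3)[OF k uv refl] by blast
    have "w \<in> L u" "w \<in> L v"
      using w k cube_dist_sym[of w v] by (auto simp: L_def)
    moreover have "on_shortest_path u w v" using w by (simp add: on_shortest_path_def)
    ultimately show "\<exists>w\<in>L u \<inter> L v. on_shortest_path u w v" by blast
  qed
  have one: "real (card (W k)) * real (d choose j) \<le> 4 * real (d + 1) ^ 2 * (5/2) ^ d"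
    if k: "k \<le> d" and j: "j = k div 2 \<or> j = k - k div 2" for k j
  proof -
    have "real (card (W k)) * real (d choose j)
        \<le> (2 * real d + 2) * 2 ^ d / real (k choose (k div 2)) * real (d choose j)"
      using W(2)[OF k] by (intro mult_right_mono) auto
    also have "\<dots> = (2 * real d + 2) * 2 ^ d * (real (d choose j) / real (k choose (k div 2)))" by simp
    also have "\<dots> \<le> (2 * real d + 2) * 2 ^ d * (2 * real (d + 1) * (5/4) ^ d)"
      using binomial_quotient_le[OF k j] by (intro mult_left_mono) auto
    also have "\<dots> = 4 * real (d + 1) ^ 2 * (2 ^ d * (5/4) ^ d)"
      by (simp add: power2_eq_square algebra_simps)
    also have "2 ^ d * (5/4) ^ d = (5/2 :: real) ^ d" by (simp flip: power_mult_distrib)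
    finally show ?thesis .
  qed
  have "OPT d \<le> hub_size d L" using hub by (rule OPT_le)
  also have "\<dots> \<le> (\<Sum>v\<in>?V. \<Sum>k\<le>d. card (?S k v (k div 2)) + card (?S k v (k - k div 2)))"
    unfolding hub_size_def L_def
    by (intro sum_mono order_trans[OF card_UN_le] card_Un_le) auto
  also have "\<dots> = (\<Sum>k\<le>d. \<Sum>v\<in>?V. card (?S k v (k div 2)) + card (?S k v (k - k div 2)))"
    by (rule sum.swap)
  also have "\<dots> = (\<Sum>k\<le>d. card (W k) * (d choose (k div 2)) + card (W k) * (d choose (k - k div 2)))"
    using W(1) by (intro sum.cong refl) (simp add: sum.distrib sum_card_sphere)
  finally have "real (OPT d) \<le> real (\<Sum>k\<le>d. card (W k) * (d choose (k div 2)) + card (W k) * (d choose (k - k div 2)))"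
    by (simp only: of_nat_le_iff)
  also have "\<dots> = (\<Sum>k\<le>d. real (card (W k)) * real (d choose (k div 2)) + real (card (W k)) * real (d choose (k - k div 2)))"
    by simp
  also have "\<dots> \<le> (\<Sum>k\<le>d. 4 * real (d + 1) ^ 2 * (5/2) ^ d + 4 * real (d + 1) ^ 2 * (5/2) ^ d)"
    by (intro sum_mono add_mono one) auto
  also have "\<dots> = 8 * real (d + 1) ^ 3 * (5/2) ^ d"
    by (simp add: power2_eq_square power3_eq_cube)
  finally show ?thesis .
qed

section \<open>Passage to \<open>d\<close>-th roots\<close>

theorem mainTheorem5:
  shows "\<exists>\<epsilon> :: nat \<Rightarrow> real. \<epsilon> \<longlonglongrightarrow> 0 \<and>
           (\<forall>d. real (OPT d) = (5/2 + \<epsilon> d) ^ d)"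
proof -
  have root_power_mult: "root d ((5/2) ^ d * x) = 5/2 * x powr (1 / real d)"
    if "0 < d" "0 \<le> x" for d x
  proof -
    have "root d ((5/2) ^ d) = 5/2" using that by (intro real_root_power_cancel) auto
    then show ?thesis unfolding real_root_mult using that by (simp add: root_powr_inverse)
  qed
  \<comment> \<open>For \<open>d > 0\<close> this is the value that solves the required equation by
    taking roots. Its limit is 0 because the \<open>d\<close>-th root of a polynomial factor tends
    to 1.\<close>
  define \<epsilon> where "\<epsilon> d = root d (real (OPT d)) - 5/2" for d
  have "(\<lambda>d. root d (real (OPT d))) \<longlonglongrightarrow> 5/2"
  proof (rule tendsto_sandwich)
    show "\<forall>\<^sub>F d in sequentially. 5/2 * (1 / (2 * real (d + 1))) powr (1 / real d) \<le> root d (real (OPT d))"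
      using eventually_gt_at_top[of 0]
    proof eventually_elim
      case (elim d)
      have "(5/2) ^ d / (2 * real (d + 1)) \<le> real (OPT d)"
        using OPT_lower[of d] by (intro mult_imp_div_pos_le) (simp, simp only: mult_ac)
      then have "(5/2) ^ d * (1 / (2 * real (d + 1))) \<le> real (OPT d)"
        by (simp only: times_divide_eq_right mult_1_right)
      then have "root d ((5/2) ^ d * (1 / (2 * real (d + 1)))) \<le> root d (real (OPT d))"
        using elim by (intro real_root_le_mono)
      then show ?case using elim by (subst (asm) root_power_mult) auto
    qed
    show "\<forall>\<^sub>F d in sequentially. root d (real (OPT d)) \<le> 5/2 * (8 * real (d + 1) ^ 3) powr (1 / real d)"
      using eventually_gt_at_top[of 0]
    proof eventually_elim
      case (elim d)
      have "root d (real (OPT d)) \<le> root d ((5/2) ^ d * (8 * real (d + 1) ^ 3))"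
        using OPT_upper[of d] elim by (intro real_root_le_mono) (auto simp: mult_ac)
      then show ?case using elim by (subst (asm) root_power_mult) auto
    qed
    show "(\<lambda>d. 5/2 * (1 / (2 * real (d + 1))) powr (1 / real d)) \<longlonglongrightarrow> 5/2" by real_asymp
    show "(\<lambda>d. 5/2 * (8 * real (d + 1) ^ 3) powr (1 / real d)) \<longlonglongrightarrow> 5/2" by real_asymp
  qed
  then have "\<epsilon> \<longlonglongrightarrow> 0"
    unfolding \<epsilon>_def by (simp add: LIM_zero)
  moreover have "real (OPT d) = (5/2 + \<epsilon> d) ^ d" for d
  proof (cases "d = 0")
    \<comment> \<open>\<open>root 0\<close> has the default value 0, but the zeroth power is 1
      whatever \<open>\<epsilon> 0\<close> is. So \<open>OPT 0 = 1\<close> has to be checked: the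
      single vertex is its own hub.\<close>
    case True
    have "OPT 0 \<le> hub_size 0 (\<lambda>_. {{}})"
      by (rule OPT_le) (auto simp: hub_labeling_def cube_vertices_def on_shortest_path_def cube_dist_def)
    then have "OPT 0 \<le> 1" by (simp add: hub_size_def cube_vertices_def)
    moreover have "OPT 0 \<noteq> 0" using OPT_lower[of 0] by auto
    ultimately show ?thesis using True by simp
  next
    case False
    then show ?thesis by (simp add: \<epsilon>_def)
  qed
  ultimately show ?thesis by blast
qed

end
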